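(* Consider an ontological model of a quantum system $S$. Let $\{\psi_i\}$ be an orthonormal basis of pure states of the Hilbert space of $S$ and let $\Pi_{E_i}=|\psi_i\rangle\langle\psi_i|$ be the corresponding rank-1 projective measurements, so that $\Pi_{E_i}\Pi_{E_j}=0$ for $i\neq j$, $\sum_i\Pi_{E_i}=1$, and $\Pi_{E_i}|\psi_j\rangle=\delta_{ij}|\psi_j\rangle$, which is $0$ for $i\neq j$. Let $M$ be any measurement setting in which the $\Pi_{E_i}$ are jointly measured. Then for all $i\neq j$, $$\mathrm{Supp}(\xi_{E_i}(\lambda,M))\cap\mathrm{Supp}(\rho(\lambda|\psi_j))=0,$$ where "$=0$" means, more precisely, that the intersection has zero measure.
   Context: An ontological model of a quantum system $S$ has an ontological space $\Lambda$, whose points $\lambda$ are called ontic states, with a measure over ontic states written $d\lambda$. For each pure quantum state $\psi$ and each preparation setting $P$ of $\psi$ there is a probability distribution $\rho(\lambda|\psi,P)$ over $\Lambda$. For each POVM $\{E_i\}$ ($E_i\ge 0$, $\sum_iE_i=1$; projective measurements are a special case) and each measurement setting $M$ implementing it, there are indicator functions $\xi_{E_i}(\lambda,M)$, giving the probability that the ontic state $\lambda$ responds with outcome $E_i$, with $\sum_i\xi_{E_i}(\lambda,M)=1$. The model reproduces Born's rule for all settings: $\int d\lambda\,\xi_{E_i}(\lambda,M)\rho(\lambda|\psi,P)=\langle\psi|E_i|\psi\rangle$. $\mathrm{Supp}$ denotes the support of a function on $\Lambda$. When the preparation label $P$ is omitted, $\mathrm{Supp}(\rho(\lambda|\psi))$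 is the union of the supports $\mathrm{Supp}(\rho(\lambda|\psi,P))$ over all possible preparation settings $P$ of $\psi$.
   Formalization: The literal union of supports over all preparation settings is treated only for countably many settings; for arbitrary settings the claim is proved for each P and for the union modulo null sets, since the literal claim fails when uncountably many densities are altered at single points. *)

theory Defs
  imports "HOL-Analysis.Analysis"
begin

section \<open>Complex Hilbert spaces\<close>

text \<open>The inner product is antilinear in the first and linear in the second argument. Positive
  definiteness and compatibility with the norm are both contained in \<open>cinner_self\<close>;
  completeness comes from \<^class>\<open>banach\<close>. The dimension is arbitrary.\<close>

class complex_hilbert = banach +
  fixes cscale :: "complex \<Rightarrow> 'a \<Rightarrow> 'a"  (infixr "*\<^sub>c" 75)
    and cinner :: "'a \<Rightarrow> 'a \<Rightarrow> complex"
  assumes cscale_add_right: "a *\<^sub>c (x + y) = a *\<^sub>c x + a *\<^sub>c y"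
    and cscale_add_left: "(a + b) *\<^sub>c x = a *\<^sub>c x + b *\<^sub>c x"
    and cscale_cscale: "a *\<^sub>c b *\<^sub>c x = (a * b) *\<^sub>c x"
    and cscale_of_real: "complex_of_real r *\<^sub>c x = r *\<^sub>R x"
    and cinner_commute: "cinner x y = cnj (cinner y x)"
    and cinner_add_right: "cinner x (y + z) = cinner x y + cinner x z"
    and cinner_cscale_right: "cinner x (a *\<^sub>c y) = a * cinner x y"
    and cinner_self: "cinner x x = complex_of_real ((norm x)\<^sup>2)"

instantiation complex :: complex_hilbert
begin

definition cscale_complex :: "complex \<Rightarrow> complex \<Rightarrow> complex"
  where "cscale_complex a x = a * x"

definition cinner_complex :: "complex \<Rightarrow> complex \<Rightarrow> complex"
  where "cinner_complex x y = cnj x * y"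

instance
proof
  fix x :: complex
  show "cinner x x = complex_of_real ((norm x)\<^sup>2)"
    unfolding cinner_complex_def by (metis complex_norm_square mult.commute)
qed (simp_all add: cscale_complex_def cinner_complex_def algebra_simps scaleR_conv_of_real)

end

instantiation vec :: (complex_hilbert, finite) complex_hilbert
begin

definition cscale_vec :: "complex \<Rightarrow> 'a ^ 'b \<Rightarrow> 'a ^ 'b"
  where "cscale_vec a x = (\<chi> k. a *\<^sub>c (x $ k))"

definition cinner_vec :: "'a ^ 'b \<Rightarrow> 'a ^ 'b \<Rightarrow> complex"
  where "cinner_vec x y = (\<Sum>k\<in>UNIV. cinner (x $ k) (y $ k))"

instance
proof
  fix x y z :: "'a ^ 'b" and a b :: complex and r :: real
  show "a *\<^sub>c (x + y) = a *\<^sub>c x + a *\<^sub>c y"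
    by (simp add: cscale_vec_def vec_eq_iff cscale_add_right)
  show "(a + b) *\<^sub>c x = a *\<^sub>c x + b *\<^sub>c x"
    by (simp add: cscale_vec_def vec_eq_iff cscale_add_left)
  show "a *\<^sub>c b *\<^sub>c x = (a * b) *\<^sub>c x"
    by (simp add: cscale_vec_def vec_eq_iff cscale_cscale)
  show "complex_of_real r *\<^sub>c x = r *\<^sub>R x"
    by (simp add: cscale_vec_def vec_eq_iff cscale_of_real)
  show "cinner x y = cnj (cinner y x)"
    unfolding cinner_vec_def cnj_sum by (intro sum.cong refl cinner_commute)
  show "cinner x (y + z) = cinner x y + cinner x z"
    by (simp add: cinner_vec_def cinner_add_right sum.distrib)
  show "cinner x (a *\<^sub>c y) = a * cinner x y"
    by (simp add: cinner_vec_def cscale_vec_def cinner_cscale_right sum_distrib_left)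
  show "cinner x x = complex_of_real ((norm x)\<^sup>2)"
    by (simp add: cinner_vec_def cinner_self norm_vec_def L2_set_def sum_nonneg)
qed

end


section \<open>Orthonormal bases, rank-one projections, POVMs\<close>

definition orthonormal_basis :: "'i set \<Rightarrow> ('i \<Rightarrow> 'a::complex_hilbert) \<Rightarrow> bool"
  where "orthonormal_basis I \<psi> \<longleftrightarrow>
    (\<forall>i\<in>I. \<forall>j\<in>I. cinner (\<psi> i) (\<psi> j) = (if i = j then 1 else 0)) \<and>
    closure (module.span cscale (\<psi> ` I)) = UNIV"

text \<open>\<open>ket_bra \<psi>\<close> is the operator \<open>|\<psi>\<rangle>\<langle>\<psi>|\<close>.\<close>

definition ket_bra :: "'a::complex_hilbert \<Rightarrow> 'a \<Rightarrow> 'a"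
  where "ket_bra \<psi> x = cinner \<psi> x *\<^sub>c \<psi>"

definition positive_operator :: "('a::complex_hilbert \<Rightarrow> 'a) \<Rightarrow> bool"
  where "positive_operator A \<longleftrightarrow>
    bounded_linear A \<and> Vector_Spaces.linear cscale cscale A \<and>
    (\<forall>x. cinner x (A x) \<in> \<real>\<^sub>\<ge>\<^sub>0)"

text \<open>Outcomes are labelled by an index set, so that an effect may occur more than once. The
  sum of the effects is the identity in the strong operator topology.\<close>

definition povm :: "'i set \<Rightarrow> ('i \<Rightarrow> 'a::complex_hilbert \<Rightarrow> 'a) \<Rightarrow> bool"
  where "povm I E \<longleftrightarrow>
    (\<forall>i\<in>I. positive_operator (E i)) \<and> (\<forall>x. ((\<lambda>i. E i x) has_sum x) I)"


section \<open>Ontological models\<close>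

text \<open>The ontological space is \<open>space \<mu>\<close>, with \<open>d\<lambda>\<close> the measure \<open>\<mu>\<close>. A pure state is given by
  a unit vector \<open>\<psi>\<close>, \<open>preps \<psi>\<close> is the set of its preparation settings, and \<open>\<rho> \<psi> P\<close> is the
  density \<open>\<rho>(\<lambda>|\<psi>,P)\<close>. \<open>meas I E\<close> is the set of measurement settings which implement the POVM
  \<open>E\<close> with outcomes in \<open>I\<close>, and \<open>\<xi> I E M i\<close> is the indicator function of outcome \<open>i\<close> in the
  setting \<open>M\<close> of this POVM.\<close>

locale ontological_model =
  fixes \<mu> :: "'l measure"
    and preps :: "'a::complex_hilbert \<Rightarrow> 'p set"
    and \<rho> :: "'a \<Rightarrow> 'p \<Rightarrow> 'l \<Rightarrow> real"
    and meas :: "'i set \<Rightarrow> ('i \<Rightarrow> 'a \<Rightarrow> 'a) \<Rightarrow> 'm set"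
    and \<xi> :: "'i set \<Rightarrow> ('i \<Rightarrow> 'a \<Rightarrow> 'a) \<Rightarrow> 'm \<Rightarrow> 'i \<Rightarrow> 'l \<Rightarrow> real"
  assumes density_nonneg:
      "\<lbrakk>norm \<psi> = 1; P \<in> preps \<psi>; l \<in> space \<mu>\<rbrakk> \<Longrightarrow> 0 \<le> \<rho> \<psi> P l"
    and density_integrable:
      "\<lbrakk>norm \<psi> = 1; P \<in> preps \<psi>\<rbrakk> \<Longrightarrow> integrable \<mu> (\<rho> \<psi> P)"
    and density_integral:
      "\<lbrakk>norm \<psi> = 1; P \<in> preps \<psi>\<rbrakk> \<Longrightarrow> (\<integral>l. \<rho> \<psi> P l \<partial>\<mu>) = 1"
    and response_measurable:
      "\<lbrakk>povm I E; M \<in> meas I E; i \<in> I\<rbrakk> \<Longrightarrow> \<xi> I E M i \<in> borel_measurable \<mu>"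
    and response_nonneg:
      "\<lbrakk>povm I E; M \<in> meas I E; i \<in> I; l \<in> space \<mu>\<rbrakk> \<Longrightarrow> 0 \<le> \<xi> I E M i l"
    and response_sum:
      "\<lbrakk>povm I E; M \<in> meas I E; l \<in> space \<mu>\<rbrakk> \<Longrightarrow> ((\<lambda>i. \<xi> I E M i l) has_sum 1) I"
    and born_rule:
      "\<lbrakk>povm I E; M \<in> meas I E; i \<in> I; norm \<psi> = 1; P \<in> preps \<psi>\<rbrakk> \<Longrightarrow>
        complex_of_real (\<integral>l. \<xi> I E M i l * \<rho> \<psi> P l \<partial>\<mu>) = cinner \<psi> (E i \<psi>)"


section \<open>Supports\<close>

text \<open>The ontological space carries no topology, so no closure is taken.\<close>

definition supp :: "'l measure \<Rightarrow> ('l \<Rightarrow> real) \<Rightarrow> 'l set"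
  where "supp \<mu> f = {l \<in> space \<mu>. f l \<noteq> 0}"

definition state_supp ::
    "'l measure \<Rightarrow> ('a \<Rightarrow> 'p set) \<Rightarrow> ('a \<Rightarrow> 'p \<Rightarrow> 'l \<Rightarrow> real) \<Rightarrow> 'a \<Rightarrow> 'l set"
  where "state_supp \<mu> preps \<rho> \<psi> = (\<Union>P\<in>preps \<psi>. supp \<mu> (\<rho> \<psi> P))"

text \<open>Densities are only determined up to null sets, and an uncountable union of sets is not
  stable under changing each of them by a null set: altering, for each of uncountably many
  settings \<open>P\<close>, the density \<open>\<rho>(\<lambda>|\<psi>,P)\<close> at one point affects no integral, but may turn the union
  of the supports into the whole space. For an arbitrary family of supports the union is
  therefore also considered modulo null sets, as the least upper bound with respect to inclusion
  up to null sets. For countable families this is the usual union.\<close>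

definition essential_union :: "'l measure \<Rightarrow> 'l set set \<Rightarrow> 'l set \<Rightarrow> bool"
  where "essential_union \<mu> \<A> S \<longleftrightarrow>
    S \<in> sets \<mu> \<and> (\<forall>A\<in>\<A>. A - S \<in> null_sets \<mu>) \<and>
    (\<forall>T\<in>sets \<mu>. (\<forall>A\<in>\<A>. A - T \<in> null_sets \<mu>) \<longrightarrow> S - T \<in> null_sets \<mu>)"

lemma essential_union_countable:
  assumes "countable \<A>" and "\<A> \<subseteq> sets \<mu>"
  shows "essential_union \<mu> \<A> (\<Union>\<A>)"
  unfolding essential_union_def
proof (intro conjI ballI impI)
  show "\<Union>\<A> \<in> sets \<mu>"
    using assms by (intro sets.countable_Union)
next
  fix A assume "A \<in> \<A>"
  then have *: "A - \<Union>\<A> = {}" by blast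
  show "A - \<Union>\<A> \<in> null_sets \<mu>" unfolding * by simp
next
  fix T assume "\<forall>A\<in>\<A>. A - T \<in> null_sets \<mu>"
  then have "(\<Union>A\<in>\<A>. A - T) \<in> null_sets \<mu>"
    using assms(1) by (intro null_sets_UN') auto
  moreover have "(\<Union>A\<in>\<A>. A - T) = \<Union>\<A> - T" by blast
  ultimately show "\<Union>\<A> - T \<in> null_sets \<mu>" by simp
qed

end

theory Submission
  imports Defs
begin

text \<open>By Born's rule, the product of \<open>\<xi>\<^sub>i\<close> and any density of \<open>\<psi>\<^sub>j\<close> has integral
  \<open>|\<langle>\<psi>\<^sub>i|\<psi>\<^sub>j\<rangle>|\<^sup>2 = 0\<close>; being nonnegative, it vanishes almost everywhere. To apply Born's rule one
  needs that the projections \<open>|\<psi>\<^sub>i\<rangle>\<langle>\<psi>\<^sub>i|\<close> form a POVM, i.e. sum strongly to the identity. They do so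
  on the linear span of the basis, and finite partial sums do not increase norms, so
  the convergence extends to the closure of the span.\<close>

section \<open>Complex linear algebra and inner product identities\<close>

interpretation cscale: vector_space "cscale :: complex \<Rightarrow> 'a \<Rightarrow> 'a::complex_hilbert"
proof
  fix x :: 'a
  \<comment> \<open>The unit law is inherited from real scaling, with which complex scaling by a
    real number agrees.\<close>
  show "1 *\<^sub>c x = x"
    using cscale_of_real[of 1 x] by simp
qed (simp_all add: cscale_add_right cscale_add_left cscale_cscale)

lemma cinner_add_left: "cinner (x + y) z = cinner x z + cinner y z"
  by (metis cinner_add_right cinner_commute complex_cnj_add)

text \<open>Additivity alone already yields the rules for finite sums, differences and zero
  collected below.\<close>

lemma additive_cinner: "Modules.additive (cinner x)"
  by standard (rule cinner_add_right)

lemmas cinner_sum_right = Modules.additive.sum[OF additive_cinner]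
lemmas cinner_diff_right = Modules.additive.diff[OF additive_cinner]
lemmas cinner_zero_right = Modules.additive.zero[OF additive_cinner]

lemma cinner_eq_0_commute: "cinner x y = 0 \<longleftrightarrow> cinner y x = 0"
  by (metis cinner_commute complex_cnj_zero_iff)

lemma norm_add_Pythagorean:
  assumes "cinner x y = 0"
  shows "(norm (x + y))\<^sup>2 = (norm x)\<^sup>2 + (norm y)\<^sup>2"
proof -
  have "complex_of_real ((norm (x + y))\<^sup>2) = cinner (x + y) (x + y)"
    by (rule cinner_self[symmetric])
  also have "\<dots> = cinner x x + cinner y y"
    using assms cinner_eq_0_commute[of x y] by (simp add: cinner_add_left cinner_add_right)
  also have "\<dots> = complex_of_real ((norm x)\<^sup>2 + (norm y)\<^sup>2)"
    by (simp add: cinner_self)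
  finally show ?thesis
    using of_real_eq_iff by blast
qed

section \<open>Rank-one projections and their finite sums\<close>

lemma ket_bra_add: "ket_bra \<psi> (x + y) = ket_bra \<psi> x + ket_bra \<psi> y"
  by (simp add: ket_bra_def cinner_add_right cscale_add_left)

lemma ket_bra_cscale: "ket_bra \<psi> (a *\<^sub>c x) = a *\<^sub>c ket_bra \<psi> x"
  by (simp add: ket_bra_def cinner_cscale_right)

lemma ket_bra_diff: "ket_bra \<psi> (x - y) = ket_bra \<psi> x - ket_bra \<psi> y"
  by (simp add: ket_bra_def cinner_diff_right cscale.scale_left_diff_distrib)

text \<open>The residual is orthogonal to every \<open>\<psi> k\<close> with \<open>k\<close> in
  \<open>F\<close>, hence to the partial sum, so Pythagoras applies. The first summand serves to
  bound a single projection, the second to bound residuals uniformly in \<open>F\<close>.\<close>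

lemma norm_ket_bra_Pythagorean:
  assumes "finite F"
    and "\<And>i j. \<lbrakk>i \<in> F; j \<in> F\<rbrakk> \<Longrightarrow> cinner (\<psi> i) (\<psi> j) = (if i = j then 1 else 0)"
  shows "(norm x)\<^sup>2 = (norm (\<Sum>i\<in>F. ket_bra (\<psi> i) x))\<^sup>2 + (norm (x - (\<Sum>i\<in>F. ket_bra (\<psi> i) x)))\<^sup>2"
proof -
  let ?p = "\<Sum>i\<in>F. ket_bra (\<psi> i) x"
  have "cinner (x - ?p) (\<psi> k) = 0" if "k \<in> F" for k
  proof -
    have "cinner (\<psi> k) ?p = (\<Sum>i\<in>F. cinner (\<psi> i) x * (if k = i then 1 else 0))"
      unfolding cinner_sum_right
      by (intro sum.cong refl) (simp add: ket_bra_def cinner_cscale_right assms(2) that)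
    also have "\<dots> = cinner (\<psi> k) x"
      using assms(1) that by (simp add: if_distrib cong: if_cong)
    finally show ?thesis
      by (subst cinner_eq_0_commute) (simp add: cinner_diff_right)
  qed
  then have "cinner (x - ?p) ?p = 0"
    by (simp add: cinner_sum_right ket_bra_def cinner_cscale_right)
  then have "cinner ?p (x - ?p) = 0"
    by (subst cinner_eq_0_commute)
  from norm_add_Pythagorean[OF this] show ?thesis
    by simp
qed

lemma norm_ket_bra_le:
  assumes "cinner \<psi> \<psi> = 1"
  shows "norm (ket_bra \<psi> x) \<le> norm x"
proof (rule power2_le_imp_le)
  show "(norm (ket_bra \<psi> x))\<^sup>2 \<le> (norm x)\<^sup>2"
    \<comment> \<open>A single projection is the partial sum over a one-element index set.\<close>
    by (subst norm_ket_bra_Pythagorean[of "{()}" "\<lambda>_. \<psi>"]) (simp_all add: assms)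
qed simp

lemma positive_operator_ket_bra:
  assumes "cinner \<psi> \<psi> = 1"
  shows "positive_operator (ket_bra \<psi>)"
  unfolding positive_operator_def
proof (intro conjI allI)
  show "bounded_linear (ket_bra \<psi>)"
  proof (rule bounded_linear_intro)
    show "ket_bra \<psi> (r *\<^sub>R x) = r *\<^sub>R ket_bra \<psi> x" for r x
      unfolding cscale_of_real[symmetric] by (rule ket_bra_cscale)
    show "norm (ket_bra \<psi> x) \<le> norm x * 1" for x
      using norm_ket_bra_le[OF assms] by simp
  qed (rule ket_bra_add)
  show "Vector_Spaces.linear (*\<^sub>c) (*\<^sub>c) (ket_bra \<psi>)"
    by unfold_locales (simp_all add: ket_bra_add ket_bra_cscale)
  fix x
  have "cinner x (ket_bra \<psi> x) = cinner \<psi> x * cnj (cinner \<psi> x)"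
    unfolding ket_bra_def cinner_cscale_right by (subst cinner_commute[of x \<psi>]) (rule refl)
  also have "\<dots> = complex_of_real ((cmod (cinner \<psi> x))\<^sup>2)"
    by (rule complex_norm_square[symmetric])
  finally show "cinner x (ket_bra \<psi> x) \<in> \<real>\<^sub>\<ge>\<^sub>0"
    by simp
qed

section \<open>Resolution of the identity\<close>

lemma has_sum_ket_bra_span:
  assumes orth: "\<And>i j. \<lbrakk>i \<in> I; j \<in> I\<rbrakk> \<Longrightarrow> cinner (\<psi> i) (\<psi> j) = (if i = j then 1 else 0)"
    and "y \<in> cscale.span (\<psi> ` I)"
  shows "((\<lambda>i. ket_bra (\<psi> i) y) has_sum y) I"
  using assms(2)
proof (induction rule: cscale.span_induct_alt)
  case base
  show ?case
    by (simp add: ket_bra_def cinner_zero_right)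
next
  case (step c x y)
  then obtain k where k: "k \<in> I" "x = \<psi> k"
    by blast
  have "((\<lambda>i. ket_bra (\<psi> i) (c *\<^sub>c x)) has_sum (c *\<^sub>c x)) {k}"
    using orth[of k k] k by (simp add: has_sum_finite_iff ket_bra_def cinner_cscale_right)
  \<comment> \<open>Orthogonality kills every term with index other than \<open>k\<close>, so
    enlarging the index set from \<open>{k}\<close> to \<open>I\<close> changes nothing.\<close>
  moreover have "?this \<longleftrightarrow> ((\<lambda>i. ket_bra (\<psi> i) (c *\<^sub>c x)) has_sum (c *\<^sub>c x)) I"
    using orth k by (intro has_sum_cong_neutral) (auto simp: ket_bra_def cinner_cscale_right)
  ultimately show ?case
    unfolding ket_bra_add using step.IH by (intro has_sum_add) auto
qed

lemma has_sum_ket_bra: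
  assumes "orthonormal_basis I \<psi>"
  shows "((\<lambda>i. ket_bra (\<psi> i) x) has_sum x) I"
  unfolding has_sum_def tendsto_iff
proof (intro allI impI)
  have orth: "\<And>i j. \<lbrakk>i \<in> I; j \<in> I\<rbrakk> \<Longrightarrow> cinner (\<psi> i) (\<psi> j) = (if i = j then 1 else 0)"
    using assms unfolding orthonormal_basis_def by blast
  fix e :: real assume "e > 0"
  have "x \<in> closure (cscale.span (\<psi> ` I))"
    using assms unfolding orthonormal_basis_def by simp
  then obtain y where y: "y \<in> cscale.span (\<psi> ` I)" "dist y x < e / 2"
    using \<open>e > 0\<close> by (meson closure_approachable half_gt_zero)
  have "\<forall>\<^sub>F F in finite_subsets_at_top I. dist (\<Sum>i\<in>F. ket_bra (\<psi> i) y) y < e / 2"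
    using has_sum_ket_bra_span[OF orth y(1)] \<open>e > 0\<close> unfolding has_sum_def tendsto_iff
    by (meson half_gt_zero)
  moreover have "\<forall>\<^sub>F F in finite_subsets_at_top I. finite F \<and> F \<subseteq> I"
    by (rule eventually_finite_subsets_at_top_weakI) simp
  ultimately show "\<forall>\<^sub>F F in finite_subsets_at_top I. dist (\<Sum>i\<in>F. ket_bra (\<psi> i) x) x < e"
  proof (eventually_elim)
    fix F assume near: "dist (\<Sum>i\<in>F. ket_bra (\<psi> i) y) y < e / 2" and F: "finite F \<and> F \<subseteq> I"
    let ?S = "\<lambda>z. \<Sum>i\<in>F. ket_bra (\<psi> i) z"
    \<comment> \<open>Taking the residual is a contraction for every finite \<open>F\<close>. Since
      the bound does not depend on \<open>F\<close>, the choice of \<open>y\<close> can precede that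
      of \<open>F\<close>.\<close>
    have "norm ((x - y) - ?S (x - y)) \<le> norm (x - y)"
    proof (rule power2_le_imp_le)
      have "cinner (\<psi> i) (\<psi> j) = (if i = j then 1 else 0)" if "i \<in> F" "j \<in> F" for i j
        using that F by (intro orth) auto
      from norm_ket_bra_Pythagorean[OF _ this, where x = "x - y"]
      show "(norm ((x - y) - ?S (x - y)))\<^sup>2 \<le> (norm (x - y))\<^sup>2"
        using F by (metis le_add_same_cancel2 zero_le_power2)
    qed simp
    also have "\<dots> < e / 2"
      using y(2) by (simp add: dist_norm norm_minus_commute)
    finally have "norm ((x - y) - ?S (x - y)) < e / 2" .
    moreover have "norm (?S y - y) < e / 2"
      using near by (simp add: dist_norm)
    \<comment> \<open>The error at \<open>x\<close> is the error at \<open>y\<close> minus the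
      residual of \<open>x - y\<close>. Bounding the residual as one term makes two halves of
      \<open>e\<close> suffice.\<close>
    moreover have "?S x - x = (?S y - y) - ((x - y) - ?S (x - y))"
      by (simp add: ket_bra_diff sum_subtractf)
    ultimately show "dist (?S x) x < e"
      using norm_triangle_ineq4[of "?S y - y" "(x - y) - ?S (x - y)"]
      by (simp only: dist_norm)
  qed
qed

lemma povm_ket_bra:
  assumes "orthonormal_basis I \<psi>" and "\<And>i. i \<in> I \<Longrightarrow> E i = ket_bra (\<psi> i)"
  shows "povm I E"
  unfolding povm_def
proof (intro conjI ballI allI)
  fix i assume "i \<in> I"
  then show "positive_operator (E i)"
    using assms by (auto simp: orthonormal_basis_def intro!: positive_operator_ket_bra)
next
  fix x
  show "((\<lambda>i. E i x) has_sum x) I"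
    using has_sum_ket_bra[OF assms(1)] assms(2) by (subst has_sum_cong) auto
qed

section \<open>Supports and null sets\<close>

lemma supp_measurable: "f \<in> borel_measurable \<mu> \<Longrightarrow> supp \<mu> f \<in> sets \<mu>"
  unfolding supp_def by measurable

text \<open>A product of reals is nonzero exactly where both factors are, so the intersection is the
  support of the product. Integrability matters: the Bochner integral of a non-integrable function
  is 0 by default, so its vanishing alone would prove nothing.\<close>

lemma null_supp_Int_supp:
  assumes "integrable \<mu> (\<lambda>l. f l * g l)" and "(\<integral>l. f l * g l \<partial>\<mu>) = 0"
    and "\<And>l. l \<in> space \<mu> \<Longrightarrow> 0 \<le> f l" and "\<And>l. l \<in> space \<mu> \<Longrightarrow> 0 \<le> g l"
  shows "supp \<mu> f \<inter> supp \<mu> g \<in> null_sets \<mu>"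
proof -
  have "AE l in \<mu>. f l * g l = 0"
    using assms by (subst integral_nonneg_eq_0_iff_AE[symmetric]) auto
  moreover have "supp \<mu> f \<inter> supp \<mu> g = supp \<mu> (\<lambda>l. f l * g l)"
    by (auto simp: supp_def)
  ultimately show ?thesis
    using assms(1) supp_measurable[of "\<lambda>l. f l * g l" \<mu>]
    by (simp add: supp_def AE_iff_null)
qed

text \<open>Removing \<open>B\<close> from \<open>S\<close> leaves an upper bound of the family
  modulo null sets, because \<open>B\<close> meets each member in a null set. Leastness of
  \<open>S\<close> then makes the removed part null, however large the family is.\<close>

lemma essential_union_Int_null:
  assumes "essential_union \<mu> \<A> S" and "B \<in> sets \<mu>" and "\<A> \<subseteq> sets \<mu>"
    and "\<And>A. A \<in> \<A> \<Longrightarrow> B \<inter> A \<in> null_sets \<mu>"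
  shows "B \<inter> S \<in> null_sets \<mu>"
proof -
  have S: "S \<in> sets \<mu>" "\<And>A. A \<in> \<A> \<Longrightarrow> A - S \<in> null_sets \<mu>"
    and least: "\<And>T. \<lbrakk>T \<in> sets \<mu>; \<forall>A\<in>\<A>. A - T \<in> null_sets \<mu>\<rbrakk> \<Longrightarrow> S - T \<in> null_sets \<mu>"
    using assms(1) unfolding essential_union_def by auto
  have "A - (S - B) \<in> null_sets \<mu>" if "A \<in> \<A>" for A
  proof -
    have "A - (S - B) = (A - S) \<union> (B \<inter> A)"
      by blast
    then show ?thesis
      using S(2)[OF that] assms(4)[OF that] by (simp only: null_sets.Un)
  qed
  then have "S - (S - B) \<in> null_sets \<mu>"
    using S(1) assms(2) by (intro least) auto
  moreover have "S - (S - B) = B \<inter> S"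
    by blast
  ultimately show ?thesis
    by simp
qed

section \<open>Zero Born probability in an ontological model\<close>

context ontological_model
begin

text \<open>One term of a sum of nonnegative terms cannot exceed the total. This bound lets the
  density dominate the integrand in Born's rule.\<close>

lemma response_le_1:
  assumes "povm I E" and "M \<in> meas I E" and "i \<in> I" and "l \<in> space \<mu>"
  shows "\<xi> I E M i l \<le> 1"
proof (rule has_sum_mono2)
  show "((\<lambda>i. \<xi> I E M i l) has_sum \<xi> I E M i l) {i}"
    by (simp add: has_sum_finite_iff)
  show "((\<lambda>i. \<xi> I E M i l) has_sum 1) I"
    using assms by (intro response_sum)
qed (use assms(3) response_nonneg[OF assms(1,2) _ assms(4)] in auto)

lemma null_supp_response_Int_supp_density:
  assumes "povm I E" and "M \<in> meas I E" and "i \<in> I" and "norm \<psi> = 1" and "P \<in> preps \<psi>"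
    and "cinner \<psi> (E i \<psi>) = 0"
  shows "supp \<mu> (\<xi> I E M i) \<inter> supp \<mu> (\<rho> \<psi> P) \<in> null_sets \<mu>"
proof (rule null_supp_Int_supp)
  have *: "\<bar>\<xi> I E M i l * \<rho> \<psi> P l\<bar> \<le> \<bar>\<rho> \<psi> P l\<bar>" if "l \<in> space \<mu>" for l
    using response_le_1[OF assms(1-3) that] response_nonneg[OF assms(1-3) that]
    by (simp add: abs_mult mult_left_le_one_le)
  \<comment> \<open>The response lies between 0 and 1, so the product is dominated by the integrable
    density.\<close>
  show "integrable \<mu> (\<lambda>l. \<xi> I E M i l * \<rho> \<psi> P l)"
  proof (rule Bochner_Integration.integrable_bound)
    show "integrable \<mu> (\<rho> \<psi> P)"
      using assms(4,5) by (rule density_integrable)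
    then show "(\<lambda>l. \<xi> I E M i l * \<rho> \<psi> P l) \<in> borel_measurable \<mu>"
      using response_measurable[OF assms(1-3)] by simp
    show "AE l in \<mu>. norm (\<xi> I E M i l * \<rho> \<psi> P l) \<le> norm (\<rho> \<psi> P l)"
      unfolding real_norm_def using * by (rule AE_I2)
  qed
  show "(\<integral>l. \<xi> I E M i l * \<rho> \<psi> P l \<partial>\<mu>) = 0"
    using born_rule[OF assms(1-5)] assms(6) by simp
qed (simp_all add: assms(3-5) response_nonneg[OF assms(1-3)] density_nonneg)

end

theorem lemma2:
  fixes \<mu> :: "'l measure"
    and preps :: "'a::complex_hilbert \<Rightarrow> 'p set"
    and \<rho> :: "'a \<Rightarrow> 'p \<Rightarrow> 'l \<Rightarrow> real"
    and meas :: "'i set \<Rightarrow> ('i \<Rightarrow> 'a \<Rightarrow> 'a) \<Rightarrow> 'm set"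
    and \<xi> :: "'i set \<Rightarrow> ('i \<Rightarrow> 'a \<Rightarrow> 'a) \<Rightarrow> 'm \<Rightarrow> 'i \<Rightarrow> 'l \<Rightarrow> real"
    and I :: "'i set" and \<psi> :: "'i \<Rightarrow> 'a" and E :: "'i \<Rightarrow> 'a \<Rightarrow> 'a" and M :: 'm
  assumes "ontological_model \<mu> preps \<rho> meas \<xi>"
    and "orthonormal_basis I \<psi>"
    and "\<And>i. i \<in> I \<Longrightarrow> E i = ket_bra (\<psi> i)"
    and "M \<in> meas I E"
  shows "\<forall>i\<in>I. \<forall>j\<in>I. i \<noteq> j \<longrightarrow>
    (countable (preps (\<psi> j)) \<longrightarrow>
      supp \<mu> (\<xi> I E M i) \<inter> state_supp \<mu> preps \<rho> (\<psi> j) \<in> null_sets \<mu>) \<and>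
    (\<forall>P\<in>preps (\<psi> j). supp \<mu> (\<xi> I E M i) \<inter> supp \<mu> (\<rho> (\<psi> j) P) \<in> null_sets \<mu>) \<and>
    (\<forall>S. essential_union \<mu> ((\<lambda>P. supp \<mu> (\<rho> (\<psi> j) P)) ` preps (\<psi> j)) S \<longrightarrow>
      supp \<mu> (\<xi> I E M i) \<inter> S \<in> null_sets \<mu>)"
proof (intro ballI impI conjI allI)
  interpret ontological_model \<mu> preps \<rho> meas \<xi>
    by (rule assms(1))
  fix i j assume ij: "i \<in> I" "j \<in> I" "i \<noteq> j"
  \<comment> \<open>The response axioms and Born's rule become available for \<open>M\<close> only
    once \<open>E\<close> is known to be a POVM.\<close>
  have povm: "povm I E"
    using assms(2,3) by (rule povm_ket_bra)
  \<comment> \<open>The case \<open>k = j\<close> gives normalization, which the density axioms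
    require; the case \<open>k = i\<close> gives the vanishing Born probability.\<close>
  have orth: "\<And>k. k \<in> I \<Longrightarrow> cinner (\<psi> k) (\<psi> j) = (if k = j then 1 else 0)"
    using assms(2) ij unfolding orthonormal_basis_def by blast
  have norm: "norm (\<psi> j) = 1"
    using orth[OF ij(2)] cinner_self[of "\<psi> j"] norm_ge_zero[of "\<psi> j"]
    by (simp add: power2_eq_1_iff flip: of_real_power)
  have "cinner (\<psi> j) (E i (\<psi> j)) = 0"
    using ij orth[OF ij(1)] by (simp add: assms(3) ket_bra_def cinner_zero_right)
  then have null: "supp \<mu> (\<xi> I E M i) \<inter> supp \<mu> (\<rho> (\<psi> j) P) \<in> null_sets \<mu>"
    if "P \<in> preps (\<psi> j)" for P
    using null_supp_response_Int_supp_density[OF povm assms(4) ij(1) norm that] by blast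
  show "supp \<mu> (\<xi> I E M i) \<inter> supp \<mu> (\<rho> (\<psi> j) P) \<in> null_sets \<mu>"
    if "P \<in> preps (\<psi> j)" for P
    using that by (rule null)
  show "supp \<mu> (\<xi> I E M i) \<inter> state_supp \<mu> preps \<rho> (\<psi> j) \<in> null_sets \<mu>"
    if "countable (preps (\<psi> j))"
    \<comment> \<open>The intersection distributes over the settings, leaving a countable union of
      null sets.\<close>
    unfolding state_supp_def Int_UN_distrib using that null by (rule null_sets_UN')
  show "supp \<mu> (\<xi> I E M i) \<inter> S \<in> null_sets \<mu>"
    if "essential_union \<mu> ((\<lambda>P. supp \<mu> (\<rho> (\<psi> j) P)) ` preps (\<psi> j)) S" for S
    using that
  \<comment> \<open>For arbitrarily many settings, leastness of \<open>S\<close> takes the place of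
    countable additivity.\<close>
  proof (rule essential_union_Int_null)
    show "supp \<mu> (\<xi> I E M i) \<in> sets \<mu>"
      using response_measurable[OF povm assms(4) ij(1)] by (rule supp_measurable)
    show "(\<lambda>P. supp \<mu> (\<rho> (\<psi> j) P)) ` preps (\<psi> j) \<subseteq> sets \<mu>"
      using density_integrable[OF norm] by (auto intro: supp_measurable)
    show "supp \<mu> (\<xi> I E M i) \<inter> A \<in> null_sets \<mu>"
      if "A \<in> (\<lambda>P. supp \<mu> (\<rho> (\<psi> j) P)) ` preps (\<psi> j)" for A
      using that null by blast
  qed
qed

end
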